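(* Let $(W,\mathcal{F})$ be an opinion space such that $\mathcal{F}$ is a countably infinite partition of $W$, and let $\mathscr{I}$ be a generalized legitimate inaccuracy measure. Then for every credence function $c$ on $\mathcal{F}$ the following are equivalent: (1) $c$ is coherent; (2) $c$ is not weakly dominated relative to $\mathscr{I}$ (by any credence function on $\mathcal{F}$); (3) $c$ is not strongly dominated relative to $\mathscr{I}$ (by any credence function on $\mathcal{F}$).
   Context: An opinion space is a pair $(W,\mathcal{F})$ with $W$ a nonempty set and $\mathcal{F}\subseteq\mathcal{P}(W)$. A credence function on $\mathcal{F}$ is any function $c:\mathcal{F}\to[0,1]$. An algebra over $W$ is a subset of $\mathcal{P}(W)$ containing $W$ and closed under binary unions and complements. $c$ is coherent if it extends to a finitely additive probability function (with value $1$ on $W$) on some algebra over $W$ containing $\mathcal{F}$. For $w\in W$, $v_w:\mathcal{F}\to\{0,1\}$ is given by $v_w(p)=1$ iff $w\in p$. A bounded one-dimensional Bregman divergence is a bounded function $\mathfrak{d}:[0,1]^2\to[0,\infty)$ of the form $\mathfrak{d}(x,y)=\varphi(x)-\varphi(y)-\varphi'(y)(x-y)$, where $\varphi:[0,1]\to\mathbb{R}$ is continuous and strictly convex on $[0,1]$, continuously differentiable on $(0,1)$, and $\varphi'(i):=\lim_{x\to i}\varphi'(x)$ for $i\in\{0,1\}$ (boundedness of $\mathfrak{d}$ is equivalent to these limits being finite). For countably infinite $\mathcal{F}=\{p_1,p_2,\ldots\}$ (enumerated without repetition), a generalized legitimate inaccuracy measure is a map $\mathscr{I}(c,w)=\sum_{i=1}^\infty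 a_i\,\mathfrak{d}(v_w(p_i),c(p_i))\in[0,\infty]$ ($c$ a credence function, $w\in W$), with $\mathfrak{d}$ a bounded one-dimensional Bregman divergence and $a_i\in(0,\infty)$, $\sup_i a_i<\infty$. A credence function $d$ weakly dominates $c$ relative to $\mathscr{I}$ if $\mathscr{I}(c,w)\ge\mathscr{I}(d,w)$ for all $w\in W$, with strict inequality for some $w\in W$; $d$ strongly dominates $c$ if $\mathscr{I}(c,w)>\mathscr{I}(d,w)$ for all $w\in W$. *)

theory Defs
  imports "HOL-Analysis.Analysis"
begin

definition opinion_space :: "'w set \<Rightarrow> 'w set set \<Rightarrow> bool" where
  "opinion_space W F \<longleftrightarrow> W \<noteq> {} \<and> F \<subseteq> Pow W"

text \<open>Functions with domain \<open>F\<close> are represented by total functions whose values outside \<open>F\<close> are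
  ignored.\<close>

definition credence_function :: "'w set set \<Rightarrow> ('w set \<Rightarrow> real) \<Rightarrow> bool" where
  "credence_function F c \<longleftrightarrow> c \<in> F \<rightarrow> {0..1}"

definition finitely_additive_probability :: "'w set \<Rightarrow> 'w set set \<Rightarrow> ('w set \<Rightarrow> real) \<Rightarrow> bool" where
  "finitely_additive_probability W A P \<longleftrightarrow>
     P \<in> A \<rightarrow> {0..1} \<and> P W = 1 \<and>
     (\<forall>p\<in>A. \<forall>q\<in>A. p \<inter> q = {} \<longrightarrow> P (p \<union> q) = P p + P q)"

definition coherent :: "'w set \<Rightarrow> 'w set set \<Rightarrow> ('w set \<Rightarrow> real) \<Rightarrow> bool" where
  "coherent W F c \<longleftrightarrow>
     (\<exists>A P. algebra W A \<and> F \<subseteq> A \<and> finitely_additive_probability W A P \<and> (\<forall>p\<in>F. P p = c p))"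

definition strictly_convex_on :: "real set \<Rightarrow> (real \<Rightarrow> real) \<Rightarrow> bool" where
  "strictly_convex_on S f \<longleftrightarrow> convex S \<and>
     (\<forall>x\<in>S. \<forall>y\<in>S. \<forall>t\<in>{0<..<1}. x \<noteq> y \<longrightarrow>
        f ((1 - t) * x + t * y) < (1 - t) * f x + t * f y)"

text \<open>\<open>\<phi>'\<close> is the derivative of \<open>\<phi>\<close> on the open unit interval, and its values at the endpoints are
  the limits. These limits are taken to be real: for an infinite limit at \<open>y \<in> {0, 1}\<close> the
  defining formula would give \<open>\<dd> x y = \<infinity>\<close> for \<open>x \<noteq> y\<close>, so that \<open>\<dd>\<close> would not be bounded.\<close>

definition bounded_bregman_divergence :: "(real \<Rightarrow> real \<Rightarrow> real) \<Rightarrow> bool" where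
  "bounded_bregman_divergence \<dd> \<longleftrightarrow>
     (\<forall>x\<in>{0..1}. \<forall>y\<in>{0..1}. 0 \<le> \<dd> x y) \<and>
     bounded ((\<lambda>(x, y). \<dd> x y) ` ({0..1} \<times> {0..1})) \<and>
     (\<exists>\<phi> \<phi>'.
        continuous_on {0..1} \<phi> \<and> strictly_convex_on {0..1} \<phi> \<and>
        (\<forall>x\<in>{0<..<1}. (\<phi> has_real_derivative \<phi>' x) (at x)) \<and>
        continuous_on {0<..<1} \<phi>' \<and>
        (\<phi>' \<longlongrightarrow> \<phi>' 0) (at_right 0) \<and> (\<phi>' \<longlongrightarrow> \<phi>' 1) (at_left 1) \<and>
        (\<forall>x\<in>{0..1}. \<forall>y\<in>{0..1}. \<dd> x y = \<phi> x - \<phi> y - \<phi>' y * (x - y)))"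

text \<open>Here \<open>indicator p w\<close> is the truth value of \<open>p\<close> at \<open>w\<close>. The enumeration of \<open>F\<close> starts at
  index 0.\<close>

definition generalized_legitimate_inaccuracy_measure ::
    "'w set \<Rightarrow> 'w set set \<Rightarrow> (('w set \<Rightarrow> real) \<Rightarrow> 'w \<Rightarrow> ennreal) \<Rightarrow> bool" where
  "generalized_legitimate_inaccuracy_measure W F \<I> \<longleftrightarrow>
     (\<exists>(p :: nat \<Rightarrow> 'w set) (a :: nat \<Rightarrow> real) \<dd>.
        bij_betw p UNIV F \<and>
        (\<forall>i. 0 < a i) \<and> bdd_above (range a) \<and>
        bounded_bregman_divergence \<dd> \<and>
        (\<forall>c. credence_function F c \<longrightarrow>
           (\<forall>w\<in>W. \<I> c w = (\<Sum>i. ennreal (a i * \<dd> (indicator (p i) w) (c (p i)))))))"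

definition weakly_dominates ::
    "'w set \<Rightarrow> (('w set \<Rightarrow> real) \<Rightarrow> 'w \<Rightarrow> ennreal) \<Rightarrow> ('w set \<Rightarrow> real) \<Rightarrow> ('w set \<Rightarrow> real) \<Rightarrow> bool" where
  "weakly_dominates W \<I> d c \<longleftrightarrow> (\<forall>w\<in>W. \<I> c w \<ge> \<I> d w) \<and> (\<exists>w\<in>W. \<I> c w > \<I> d w)"

definition strongly_dominates ::
    "'w set \<Rightarrow> (('w set \<Rightarrow> real) \<Rightarrow> 'w \<Rightarrow> ennreal) \<Rightarrow> ('w set \<Rightarrow> real) \<Rightarrow> ('w set \<Rightarrow> real) \<Rightarrow> bool" where
  "strongly_dominates W \<I> d c \<longleftrightarrow> (\<forall>w\<in>W. \<I> c w > \<I> d w)"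

end

theory Submission
  imports Defs
begin

text \<open>Let \<open>p\<^sub>0, p\<^sub>1, \<dots>\<close> be the cells and \<open>x\<^sub>i\<close> the credence in \<open>p\<^sub>i\<close>. Coherence amounts to
  \<open>\<Sum>\<^sub>i x\<^sub>i \<le> 1\<close>: the missing mass can be given to a merely finitely additive part on the algebra
  of finite and cofinite unions of cells. Put \<open>B\<^sub>x = \<Sum>\<^sub>i a\<^sub>i \<dd>(0, x\<^sub>i)\<close>. At a world in \<open>p\<^sub>k\<close> the
  inaccuracy is \<open>B\<^sub>x + a\<^sub>k (\<phi>(1) - \<phi>(0) - \<phi>'(x\<^sub>k))\<close>.

  If \<open>x\<close> is coherent, then \<open>B\<^sub>x\<close> is finite. Let \<open>y\<close> be at least as accurate as \<open>x\<close> everywhere. Then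
  \<open>\<Delta> = B\<^sub>y - B\<^sub>x\<close> is at most \<open>a\<^sub>k (\<phi>'(y\<^sub>k) - \<phi>'(x\<^sub>k))\<close> for all \<open>k\<close>, and finiteness of \<open>B\<^sub>y\<close> makes the
  latter arbitrarily small, so \<open>\<Delta> \<le> 0\<close>. Taking the expectation with respect to \<open>x\<close>, with the missing
  mass placed at infinity, gives \<open>\<Sum>\<^sub>i a\<^sub>i \<dd>(x\<^sub>i, y\<^sub>i) \<le> (1 - \<Sum>\<^sub>i x\<^sub>i) \<Delta> \<le> 0\<close>, whence \<open>y = x\<close>.

  If \<open>x\<close> is incoherent and \<open>B\<^sub>x = \<infinity>\<close>, then the zero credence function dominates. If \<open>B\<^sub>x < \<infinity>\<close>,
  finitely many credences already sum to more than \<open>1\<close>. Lower the positive ones among them slightly,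
  to \<open>y\<^sub>i\<close> with \<open>a\<^sub>i (\<phi>'(x\<^sub>i) - \<phi>'(y\<^sub>i)) = t\<close>. This decreases \<open>B\<close> by at least \<open>t \<Sum>\<^sub>i y\<^sub>i > t\<close>, which
  outweighs the loss \<open>t\<close> on the cells concerned.\<close>

section \<open>Coherence over a countable partition\<close>

lemma finitely_additive_probability_UN:
  assumes "algebra W A" "finitely_additive_probability W A P"
    and "finite I" "p ` I \<subseteq> A" "disjoint_family_on p I"
  shows "(\<Union>i\<in>I. p i) \<in> A \<and> P (\<Union>i\<in>I. p i) = (\<Sum>i\<in>I. P (p i))"
  using assms(3-)
proof (induction I rule: finite_induct)
  interpret algebra W A by fact
  have add: "P (q \<union> r) = P q + P r" if "q \<in> A" "r \<in> A" "q \<inter> r = {}" for q r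
    using assms(2) that unfolding finitely_additive_probability_def by blast
  {
    case empty
    show ?case using add[of "{}" "{}"] by simp
  next
    case (insert j I)
    have IH: "(\<Union>i\<in>I. p i) \<in> A" "P (\<Union>i\<in>I. p i) = (\<Sum>i\<in>I. P (p i))"
      using insert by (auto simp: disjoint_family_on_def)
    have "p j \<inter> (\<Union>i\<in>I. p i) = {}"
      using insert.prems insert.hyps by (fastforce simp: disjoint_family_on_def)
    then have "P (p j \<union> (\<Union>i\<in>I. p i)) = P (p j) + P (\<Union>i\<in>I. p i)"
      using IH insert.prems by (intro add) auto
    then show ?case using IH insert by auto
  }
qed

lemma coherent_sum_le_1:
  assumes "coherent W F c" "finite I" "p ` I \<subseteq> F" "disjoint_family_on p I"
  shows "(\<Sum>i\<in>I. c (p i)) \<le> 1"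
proof -
  obtain A P where A: "algebra W A" "F \<subseteq> A" "finitely_additive_probability W A P"
    and P: "\<forall>p\<in>F. P p = c p"
    using assms(1) unfolding coherent_def by blast
  have *: "(\<Union>i\<in>I. p i) \<in> A \<and> P (\<Union>i\<in>I. p i) = (\<Sum>i\<in>I. P (p i))"
    using A assms by (intro finitely_additive_probability_UN) auto
  have "(\<Sum>i\<in>I. c (p i)) = P (\<Union>i\<in>I. p i)"
    using * P assms(3) by (auto intro!: sum.cong)
  also have "\<dots> \<le> 1"
    using * A(3) unfolding finitely_additive_probability_def by (auto simp: Pi_iff)
  finally show ?thesis .
qed

text \<open>A finite union of cells gets the sum of its credences, a cofinite one gets 1 minus the
  sum over the missing cells. Any mass that the cells lack thus goes to every cofinite union without
  sitting on a cell.\<close>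

lemma coherentI_finite_sums:
  fixes p :: "nat \<Rightarrow> 'w set"
  assumes cover: "(\<Union>i. p i) = W" and disj: "disjoint_family p" and ne: "\<And>i. p i \<noteq> {}"
    and pos: "\<And>i. 0 \<le> c (p i)" and le1: "\<And>n. (\<Sum>i<n. c (p i)) \<le> 1"
  shows "coherent W (range p) c"
proof -
  define U where "U I = (\<Union>i\<in>I. p i)" for I
  \<comment> \<open>As the cells are nonempty and disjoint, \<open>idx\<close> inverts
    \<open>U\<close>, so \<open>P\<close> may be defined through index sets.\<close>
  define idx where "idx q = {i. p i \<subseteq> q}" for q
  define S where "S I = (\<Sum>i\<in>I. c (p i))" for I
  define A where "A = U ` {I. finite I \<or> finite (- I)}"
  define P where "P q = (if finite (idx q) then S (idx q) else 1 - S (- idx q))" for q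
  have same: "i = j" if "w \<in> p i" "w \<in> p j" for i j w
    using disj that unfolding disjoint_family_on_def by blast
  have idx_U [simp]: "idx (U I) = I" for I
  proof -
    have "p i \<subseteq> U I \<longleftrightarrow> i \<in> I" for i
    proof
      assume "p i \<subseteq> U I"
      moreover obtain w where "w \<in> p i" using ne by blast
      ultimately obtain j where "j \<in> I" "w \<in> p i" "w \<in> p j" by (auto simp: U_def)
      then show "i \<in> I" using same by blast
    qed (auto simp: U_def)
    then show ?thesis by (simp add: idx_def)
  qed
  have W: "W = U UNIV" and empty: "U {} = {}" and cell: "p i = U {i}" for i
    using cover by (auto simp: U_def)
  have Un: "U I \<union> U J = U (I \<union> J)" for I J
    by (auto simp: U_def)
  have Int: "U I \<inter> U J = U (I \<inter> J)" for I J
  proof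
    show "U I \<inter> U J \<subseteq> U (I \<inter> J)"
    proof
      fix w assume "w \<in> U I \<inter> U J"
      then obtain i j where ij: "i \<in> I" "j \<in> J" "w \<in> p i" "w \<in> p j" by (auto simp: U_def)
      then have "i = j" using same by blast
      then show "w \<in> U (I \<inter> J)" using ij by (auto simp: U_def)
    qed
  qed (auto simp: U_def)
  have inj: "U I = U J \<longleftrightarrow> I = J" for I J
    by (metis idx_U)
  have compl: "W - U I = U (- I)" for I
  proof -
    have "U I \<union> U (- I) = W" "U I \<inter> U (- I) = {}"
      unfolding Un Int W by (simp_all add: empty)
    then show ?thesis by blast
  qed
  have S: "0 \<le> S I" "S I \<le> 1" if "finite I" for I
  proof -
    show "0 \<le> S I" unfolding S_def by (intro sum_nonneg pos)
    obtain n where "I \<subseteq> {..<n}"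
      using finite_nat_iff_bounded \<open>finite I\<close> by blast
    then have "S I \<le> (\<Sum>i<n. c (p i))"
      unfolding S_def by (intro sum_mono2 pos) auto
    then show "S I \<le> 1" using le1[of n] by simp
  qed
  have A_iff: "U I \<in> A \<longleftrightarrow> finite I \<or> finite (- I)" for I
    unfolding A_def by (auto simp: inj)
  have "algebra W A"
    unfolding algebra_iff_Un
  proof (intro conjI ballI)
    show "A \<subseteq> Pow W" unfolding A_def W U_def by auto
    show "{} \<in> A" using A_iff[of "{}"] by (simp add: empty)
    show "W - q \<in> A" if "q \<in> A" for q
      using that A_iff unfolding A_def by (auto simp: compl)
    show "q \<union> r \<in> A" if "q \<in> A" "r \<in> A" for q r
      using that unfolding A_def by (auto simp: Un inj intro!: imageI)
  qed
  moreover have "range p \<subseteq> A"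
    using A_iff cell by auto
  moreover have "finitely_additive_probability W A P"
    unfolding finitely_additive_probability_def
  proof (intro conjI ballI impI)
    show "P \<in> A \<rightarrow> {0..1}"
    proof
      fix q assume "q \<in> A"
      then obtain I where I: "q = U I" "finite I \<or> finite (- I)" by (auto simp: A_def)
      show "P q \<in> {0..1}"
        using I(2) S[of I] S[of "- I"] by (cases "finite I") (simp_all add: I(1) P_def)
    qed
    show "P W = 1" by (simp add: W P_def S_def)
    fix q r assume "q \<in> A" "r \<in> A" and qr: "q \<inter> r = {}"
    then obtain I J where I: "q = U I" "finite I \<or> finite (- I)" and J: "r = U J" "finite J \<or> finite (- J)"
      unfolding A_def by auto
    have IJ: "I \<inter> J = {}"
      using qr unfolding I J Int by (metis idx_U empty)
    have mixed: "S (- (K \<union> L)) = S (- K) - S L" if "finite L" "finite (- K)" "K \<inter> L = {}" for K L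
    proof -
      have "- (K \<union> L) = - K - L" by auto
      then show ?thesis unfolding S_def using that by (auto intro!: sum_diff)
    qed
    \<comment> \<open>Disjoint index sets cannot both be cofinite in an infinite set, so additivity
      never has to add two cofinite values.\<close>
    have "finite I \<or> finite J"
      using I J IJ by (metis finite_subset disjoint_eq_subset_Compl)
    then consider "finite I" "finite J" | "infinite I" "finite J" | "finite I" "infinite J" by blast
    then show "P (q \<union> r) = P q + P r"
    proof cases
      case 1
      then show ?thesis
        unfolding I J Un P_def using IJ by (simp add: S_def sum.union_disjoint)
    next
      case 2
      then show ?thesis
        unfolding I J Un P_def using IJ I mixed[of J I] by simp
    next
      case 3
      then show ?thesis
        unfolding I J Un P_def using IJ J mixed[of I J] by (simp add: Un_commute Int_commute)
    qed
  qed
  moreover have "\<forall>q\<in>range p. P q = c q"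
  proof
    fix q assume "q \<in> range p"
    then obtain i where q: "q = p i" by blast
    have "idx (p i) = {i}" by (subst cell) simp
    then show "P q = c q" unfolding q P_def by (simp add: S_def)
  qed
  ultimately show ?thesis unfolding coherent_def by blast
qed

section \<open>One-dimensional Bregman divergences\<close>

text \<open>Continuity of \<open>\<phi>'\<close> on the closed interval packs together its
  continuity inside and the two endpoint limits.\<close>

locale bregman =
  fixes \<dd> :: "real \<Rightarrow> real \<Rightarrow> real" and \<phi> \<phi>' :: "real \<Rightarrow> real"
  assumes nonneg: "\<And>x y. x \<in> {0..1} \<Longrightarrow> y \<in> {0..1} \<Longrightarrow> 0 \<le> \<dd> x y"
    and strictly_convex: "strictly_convex_on {0..1} \<phi>"
    and continuous_deriv: "continuous_on {0..1} \<phi>'"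
    and divergence_eq: "\<And>x y. x \<in> {0..1} \<Longrightarrow> y \<in> {0..1} \<Longrightarrow> \<dd> x y = \<phi> x - \<phi> y - \<phi>' y * (x - y)"

lemma bounded_bregman_divergenceE:
  assumes "bounded_bregman_divergence \<dd>"
  obtains \<phi> \<phi>' where "bregman \<dd> \<phi> \<phi>'"
proof -
  obtain \<phi> \<phi>' where *: "strictly_convex_on {0..1} \<phi>" "continuous_on {0<..<1} \<phi>'"
    "(\<phi>' \<longlongrightarrow> \<phi>' 0) (at_right 0)" "(\<phi>' \<longlongrightarrow> \<phi>' 1) (at_left 1)"
    "\<forall>x\<in>{0..1}. \<forall>y\<in>{0..1}. \<dd> x y = \<phi> x - \<phi> y - \<phi>' y * (x - y)"
    using assms unfolding bounded_bregman_divergence_def by blast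
  have "continuous_on {0..1} \<phi>'"
    unfolding continuous_on_def
  proof
    fix x :: real assume x: "x \<in> {0..1}"
    consider "x = 0" | "x = 1" | "x \<in> {0<..<1}" using x by fastforce
    then show "(\<phi>' \<longlongrightarrow> \<phi>' x) (at x within {0..1})"
    proof cases
      case 1
      then show ?thesis using * by (simp add: at_within_Icc_at_right)
    next
      case 2
      then show ?thesis using * by (simp add: at_within_Icc_at_left)
    next
      case 3
      then have "(\<phi>' \<longlongrightarrow> \<phi>' x) (at x)"
        using *(2) by (metis continuous_on_eq_continuous_at isCont_def open_greaterThanLessThan)
      then show ?thesis by (rule tendsto_within_subset) simp
    qed
  qed
  then have "bregman \<dd> \<phi> \<phi>'"
    using * assms unfolding bregman_def bounded_bregman_divergence_def by blast
  then show thesis by (rule that)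
qed

context bregman
begin

text \<open>At the midpoint \<open>m\<close>, the chord exceeds the tangent at \<open>y\<close> by
  half of \<open>\<dd> x y\<close>. The value \<open>\<phi> m\<close> lies strictly below the chord
  by strict convexity and not below the tangent by nonnegativity.\<close>

lemma positive:
  assumes "x \<in> {0..1}" "y \<in> {0..1}" "x \<noteq> y"
  shows "0 < \<dd> x y"
proof -
  define m where "m = (x + y) / 2"
  have m: "m \<in> {0..1}" using assms by (auto simp: m_def)
  have "\<forall>t\<in>{0<..<1}. \<phi> ((1 - t) * x + t * y) < (1 - t) * \<phi> x + t * \<phi> y"
    using strictly_convex assms unfolding strictly_convex_on_def by blast
  then have "\<phi> ((1 - 1/2) * x + 1/2 * y) < (1 - 1/2) * \<phi> x + 1/2 * \<phi> y"
    by (rule bspec) simp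
  then have "\<phi> m < \<phi> x / 2 + \<phi> y / 2"
    by (simp add: m_def add_divide_distrib)
  moreover have "m - y = (x - y) / 2" by (simp add: m_def field_simps)
  then have "\<dd> m y = \<phi> m - \<phi> y - \<phi>' y * (x - y) / 2"
    using divergence_eq[OF m assms(2)] by simp
  ultimately show ?thesis
    using nonneg[OF m assms(2)] divergence_eq[OF assms(1,2)] by linarith
qed

lemma refl_zero [simp]: "y \<in> {0..1} \<Longrightarrow> \<dd> y y = 0"
  by (simp add: divergence_eq)

text \<open>The symmetrized divergence is the product of the increments of \<open>\<phi>'\<close>
  and of the argument.\<close>

lemma deriv_strict_mono:
  assumes "x \<in> {0..1}" "y \<in> {0..1}" "x < y"
  shows "\<phi>' x < \<phi>' y"
proof -
  have "0 < \<dd> x y + \<dd> y x"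
    using positive assms by (intro add_pos_pos) auto
  also have "\<dots> = (\<phi>' y - \<phi>' x) * (y - x)"
    using assms by (simp add: divergence_eq algebra_simps)
  finally show ?thesis using assms by (simp add: zero_less_mult_iff)
qed

lemma deriv_mono:
  assumes "x \<in> {0..1}" "y \<in> {0..1}" "x \<le> y"
  shows "\<phi>' x \<le> \<phi>' y"
  using deriv_strict_mono[of x y] assms by (cases "x = y") auto

text \<open>Discarding \<open>\<dd> y 0\<close> from the symmetrized divergence leaves a linear
  bound, which makes \<open>base x\<close> summable for summable \<open>x\<close>.\<close>

lemma zero_divergence_le:
  assumes "y \<in> {0..1}"
  shows "\<dd> 0 y \<le> (\<phi>' 1 - \<phi>' 0) * y"
proof -
  have "\<dd> 0 y + \<dd> y 0 = (\<phi>' y - \<phi>' 0) * y"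
    using assms by (simp add: divergence_eq algebra_simps)
  then have "\<dd> 0 y \<le> (\<phi>' y - \<phi>' 0) * y"
    using nonneg[of y 0] assms by simp
  also have "\<dots> \<le> (\<phi>' 1 - \<phi>' 0) * y"
    using deriv_mono[of y 1] assms by (intro mult_right_mono) auto
  finally show ?thesis .
qed

text \<open>The two sides differ by exactly \<open>\<dd> y x\<close>. This measures how much
  \<open>base\<close> drops when a credence is lowered.\<close>

lemma zero_divergence_diff:
  assumes "x \<in> {0..1}" "y \<in> {0..1}"
  shows "y * (\<phi>' x - \<phi>' y) \<le> \<dd> 0 x - \<dd> 0 y"
proof -
  have "\<dd> 0 x - \<dd> 0 y = y * (\<phi>' x - \<phi>' y) + \<dd> y x"
    using assms by (simp add: divergence_eq algebra_simps)
  then show ?thesis using nonneg[of y x] assms by simp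
qed

lemma zero_divergence_mono:
  assumes "x \<in> {0..1}" "y \<in> {0..1}" "y \<le> x"
  shows "\<dd> 0 y \<le> \<dd> 0 x"
proof -
  have "0 \<le> y * (\<phi>' x - \<phi>' y)"
    using deriv_mono[of y x] assms by simp
  then show ?thesis using zero_divergence_diff[OF assms(1,2)] by linarith
qed

end

section \<open>Inaccuracy on the cells of a partition\<close>

text \<open>\<open>score a x k\<close> is the inaccuracy at worlds in the cell \<open>k\<close>, provided the series converges.\<close>

locale weighted_bregman = bregman +
  fixes a :: "nat \<Rightarrow> real"
  assumes weight_pos: "\<And>i. 0 < a i" and weight_bdd: "bdd_above (range a)"
begin

definition base :: "(nat \<Rightarrow> real) \<Rightarrow> nat \<Rightarrow> real" where
  "base x i = a i * \<dd> 0 (x i)"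

definition score :: "(nat \<Rightarrow> real) \<Rightarrow> nat \<Rightarrow> real" where
  "score x k = suminf (base x) + a k * (\<phi> 1 - \<phi> 0 - \<phi>' (x k))"

lemma weight_bound:
  obtains C where "0 < C" "\<And>i. a i \<le> C"
proof -
  obtain C where "\<And>i. a i \<le> C"
    using weight_bdd by (auto simp: bdd_above_def)
  moreover from this have "0 < C" using weight_pos[of 0] less_le_trans by blast
  ultimately show thesis by (rule that[rotated])
qed

text \<open>Only the cell \<open>k\<close> is true at \<open>w\<close>, so the series differs from
  that of \<open>base x\<close> in one term and converges with it. Nonnegativity is recorded because
  \<open>ennreal\<close> sends negative reals to 0, which would blur comparisons of scores.\<close>

lemma suminf_inaccuracy:
  assumes x: "\<And>i. x i \<in> {0..1}" and disj: "disjoint_family p" and w: "w \<in> p k"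
  defines "L \<equiv> \<Sum>i. ennreal (a i * \<dd> (indicator (p i) w) (x i))"
  shows "summable (base x) \<Longrightarrow> L = ennreal (score x k) \<and> 0 \<le> score x k"
    and "\<not> summable (base x) \<Longrightarrow> L = top"
proof -
  define g where "g i = a i * \<dd> (indicator (p i) w) (x i)" for i
  have ind: "indicator (p i) w = (if i = k then 1 else 0 :: real)" for i
    using disj w by (auto simp: disjoint_family_on_def indicator_def)
  have g0: "0 \<le> g i" for i
    unfolding g_def ind using x[of i] nonneg less_imp_le[OF weight_pos]
    by (intro mult_nonneg_nonneg) auto
  \<comment> \<open>The correction is
    \<open>\<dd> 1 u - \<dd> 0 u = \<phi> 1 - \<phi> 0 - \<phi>' u\<close> at
    \<open>u = x k\<close>.\<close>
  have g: "g i = base x i + (if i = k then a k * (\<phi> 1 - \<phi> 0 - \<phi>' (x k)) else 0)" for i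
    using x[of k] by (simp add: g_def ind base_def divergence_eq algebra_simps)
  have L: "L = (\<Sum>i. ennreal (g i))"
    unfolding L_def g_def ..
  {
    assume "summable (base x)"
    then have "g sums score x k"
      unfolding g score_def by (intro sums_add summable_sums sums_single)
    then show "L = ennreal (score x k) \<and> 0 \<le> score x k"
      unfolding L using g0 by (metis sums_iff suminf_ennreal2 suminf_nonneg)
  next
    assume ns: "\<not> summable (base x)"
    show "L = top"
    proof (rule ccontr)
      assume "L \<noteq> top"
      then have "summable g"
        unfolding L using g0 summable_suminf_not_top by blast
      then have "summable (\<lambda>i. g i - (if i = k then a k * (\<phi> 1 - \<phi> 0 - \<phi>' (x k)) else 0))"
        by (intro summable_diff sums_summable[OF sums_single])
      then show False using ns by (simp add: g)
    qed
  }
qed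

lemma summable_base:
  assumes x: "\<And>i. x i \<in> {0..1}" and "summable x"
  shows "summable (base x)"
proof -
  obtain C where C: "0 < C" "\<And>i. a i \<le> C" using weight_bound by blast
  show ?thesis
  proof (rule summable_comparison_test')
    show "summable (\<lambda>i. C * ((\<phi>' 1 - \<phi>' 0) * x i))"
      using assms by (intro summable_mult)
    show "norm (base x i) \<le> C * ((\<phi>' 1 - \<phi>' 0) * x i)" if "0 \<le> i" for i
    proof -
      have "0 \<le> \<dd> 0 (x i)" using nonneg x by simp
      then show ?thesis
        using C weight_pos[of i] zero_divergence_le[OF x]
        by (simp add: base_def abs_mult mult_mono)
    qed
  qed
qed

text \<open>A positive gap \<open>\<Delta>\<close> would keep every \<open>y k\<close> above some
  \<open>\<eta> > 0\<close>, since the weights are bounded above. Then \<open>base y\<close>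
  dominates a positive multiple of \<open>a\<close>, so its summability forces the weights to 0, and
  with them the upper bounds on \<open>\<Delta>\<close>.\<close>

lemma suminf_base_le:
  assumes x: "\<And>i. x i \<in> {0..1}" and y: "\<And>i. y i \<in> {0..1}"
    and sum: "summable (base y)" and le: "\<And>k. score y k \<le> score x k"
  shows "suminf (base y) \<le> suminf (base x)"
proof (rule ccontr)
  define \<Delta> where "\<Delta> = suminf (base y) - suminf (base x)"
  assume "\<not> ?thesis"
  then have pos: "0 < \<Delta>" by (simp add: \<Delta>_def)
  have \<Delta>: "\<Delta> \<le> a k * (\<phi>' (y k) - \<phi>' 0)" for k
  proof -
    have "\<Delta> \<le> a k * (\<phi>' (y k) - \<phi>' (x k))"
      using le[of k] by (simp add: \<Delta>_def score_def algebra_simps)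
    also have "\<dots> \<le> a k * (\<phi>' (y k) - \<phi>' 0)"
      using deriv_mono[of 0 "x k"] x[of k] weight_pos[of k] by (intro mult_left_mono) auto
    finally show ?thesis .
  qed
  obtain C where C: "0 < C" "\<And>i. a i \<le> C" using weight_bound by blast
  obtain \<eta> where \<eta>: "\<eta> \<in> {0<..1}" "\<phi>' \<eta> - \<phi>' 0 < \<Delta> / C"
  proof -
    obtain r where "0 < r" and r: "\<And>u. u \<in> {0..1} \<Longrightarrow> dist u 0 < r \<Longrightarrow> dist (\<phi>' u) (\<phi>' 0) < \<Delta> / C"
      using continuous_deriv pos C unfolding continuous_on_iff
      by (metis atLeastAtMost_iff divide_pos_pos order_refl zero_le_one)
    have "min 1 (r/2) < r" using \<open>0 < r\<close> by linarith
    then show thesis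
      using r[of "min 1 (r/2)"] \<open>0 < r\<close> by (intro that[of "min 1 (r/2)"]) (auto simp: dist_real_def)
  qed
  have ge: "\<eta> \<le> y k" for k
  proof (rule ccontr)
    assume "\<not> \<eta> \<le> y k"
    then have "\<phi>' (y k) \<le> \<phi>' \<eta>" "\<phi>' 0 \<le> \<phi>' (y k)"
      using y[of k] \<eta> by (auto intro!: deriv_mono)
    then have "a k * (\<phi>' (y k) - \<phi>' 0) \<le> C * (\<phi>' \<eta> - \<phi>' 0)"
      using C weight_pos[of k] by (intro mult_mono) auto
    also have "\<dots> < \<Delta>" using \<eta> C by (simp add: field_simps)
    finally show False using \<Delta>[of k] by simp
  qed
  have \<eta>d: "0 < \<dd> 0 \<eta>" using positive[of 0 \<eta>] \<eta> by auto
  have "summable (\<lambda>k. a k * \<dd> 0 \<eta>)"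
  proof (rule summable_comparison_test'[OF sum])
    show "norm (a k * \<dd> 0 \<eta>) \<le> base y k" if "0 \<le> k" for k
      using weight_pos[of k] \<eta>d zero_divergence_mono[OF y _ ge] \<eta> by (simp add: base_def abs_mult)
  qed
  then have "summable (\<lambda>k. a k * \<dd> 0 \<eta> / \<dd> 0 \<eta>)" by (rule summable_divide)
  then have "summable a" using \<eta>d by simp
  then have "(\<lambda>k. a k * (\<phi>' 1 - \<phi>' 0)) \<longlonglongrightarrow> 0"
    by (intro tendsto_mult_left_zero summable_LIMSEQ_zero)
  moreover have "\<Delta> \<le> a k * (\<phi>' 1 - \<phi>' 0)" for k
  proof -
    have "a k * (\<phi>' (y k) - \<phi>' 0) \<le> a k * (\<phi>' 1 - \<phi>' 0)"
      using deriv_mono[of "y k" 1] y[of k] weight_pos[of k] by (intro mult_left_mono) auto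
    then show ?thesis using \<Delta>[of k] by simp
  qed
  ultimately have "\<Delta> \<le> 0" by (intro LIMSEQ_le_const) auto
  then show False using pos by simp
qed

lemma eq_if_score_le:
  assumes x: "\<And>i. x i \<in> {0..1}" and y: "\<And>i. y i \<in> {0..1}"
    and sx: "summable x" and x1: "suminf x \<le> 1"
    and sy: "summable (base y)" and le: "\<And>k. score y k \<le> score x k"
  shows "y i = x i"
proof (rule ccontr)
  assume ne: "y i \<noteq> x i"
  define \<Delta> where "\<Delta> = suminf (base y) - suminf (base x)"
  \<comment> \<open>Weighting the score inequality at \<open>k\<close> by \<open>x k\<close> shows
    that \<open>g k\<close> bounds the expected divergence term
    \<open>a k * \<dd> (x k) (y k)\<close>, while the sum of \<open>g\<close> collapses to
    \<open>(1 - suminf x) * \<Delta>\<close>.\<close>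
  define g where "g k = base y k - base x k - x k * \<Delta>" for k
  have bx: "summable (base x)" using x sx by (rule summable_base)
  have \<Delta>0: "\<Delta> \<le> 0"
    using suminf_base_le[OF x y sy le] by (simp add: \<Delta>_def)
  have lower: "a k * \<dd> (x k) (y k) \<le> g k" for k
  proof -
    have "\<Delta> \<le> a k * (\<phi>' (y k) - \<phi>' (x k))"
      using le[of k] by (simp add: \<Delta>_def score_def algebra_simps)
    then have "x k * \<Delta> \<le> x k * (a k * (\<phi>' (y k) - \<phi>' (x k)))"
      using x[of k] by (intro mult_left_mono) auto
    moreover have "a k * \<dd> (x k) (y k) = base y k - base x k - x k * (a k * (\<phi>' (y k) - \<phi>' (x k)))"
      using x[of k] y[of k] by (simp add: base_def divergence_eq algebra_simps)
    ultimately show ?thesis unfolding g_def by linarith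
  qed
  have "g sums (suminf (base y) - suminf (base x) - suminf x * \<Delta>)"
    unfolding g_def using sy bx sx by (intro sums_diff sums_mult2 summable_sums)
  then have g: "g sums ((1 - suminf x) * \<Delta>)" by (simp add: \<Delta>_def algebra_simps)
  have "0 \<le> g k" for k
    using lower[of k] nonneg[OF x y, of k k] weight_pos[of k]
    by (meson less_imp_le mult_nonneg_nonneg order_trans)
  moreover have "0 < g i"
    using lower[of i] positive[OF x y, of i i] ne weight_pos[of i]
    by (metis less_le_trans mult_pos_pos)
  ultimately have "0 < suminf g" using g by (intro suminf_pos2) (auto simp: sums_iff)
  moreover have "suminf g \<le> 0"
    using g x1 \<Delta>0 by (simp add: sums_iff mult_nonneg_nonpos)
  ultimately show False by simp
qed

lemma ex_score_less:
  assumes x: "\<And>i. x i \<in> {0..1}" and gt: "1 < (\<Sum>i<n. x i)" and sx: "summable (base x)"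
  obtains y where "\<And>i. y i \<in> {0..1}" "summable (base y)" "\<And>k. score y k < score x k"
proof -
  \<comment> \<open>Zero credences cannot be lowered and contribute nothing to the sum.\<close>
  define S where "S = {i. i < n \<and> 0 < x i}"
  have fin: "finite S" by (simp add: S_def)
  have sumS: "(\<Sum>i<n. x i) = sum x S"
    unfolding S_def using x by (intro sum.mono_neutral_right) (auto simp: less_le)
  then have "1 < sum x S" using gt by simp
  then have ne: "S \<noteq> {}" by auto
  \<comment> \<open>The values \<open>r * x i\<close> serve as floors for the lowered credences:
    even there the sum over \<open>S\<close> exceeds 1.\<close>
  obtain r where r: "1 / sum x S < r" "r < 1"
    using dense[of "1 / sum x S" 1] \<open>1 < sum x S\<close> by auto
  then have r0: "0 < r" using \<open>1 < sum x S\<close> by (smt (verit) divide_pos_pos)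
  have r1: "1 < (\<Sum>i\<in>S. r * x i)"
    using r \<open>1 < sum x S\<close> by (simp add: field_simps flip: sum_distrib_left)
  have rx: "r * x i \<in> {0..1}" "r * x i \<le> x i" "i \<in> S \<Longrightarrow> r * x i < x i" for i
    using x[of i] r r0 by (auto simp: S_def mult_le_one mult_left_le_one_le)
  define gap where "gap i = a i * (\<phi>' (x i) - \<phi>' (r * x i))" for i
  \<comment> \<open>The largest common loss that all cells of \<open>S\<close> can bear without
    falling below their floors; the intermediate value theorem then realizes exactly this loss on
    each.\<close>
  define t where "t = Min (gap ` S)"
  have t_le: "t \<le> gap i" if "i \<in> S" for i
    unfolding t_def using fin that by simp
  have "0 < gap i" if "i \<in> S" for i
    using deriv_strict_mono[OF rx(1) x rx(3)[OF that]] weight_pos[of i] by (simp add: gap_def)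
  then have t: "0 < t"
    unfolding t_def using fin ne by simp
  have "\<exists>z. r * x i \<le> z \<and> z \<le> x i \<and> \<phi>' z = \<phi>' (x i) - t / a i" if i: "i \<in> S" for i
  proof (rule IVT')
    have "{r * x i..x i} \<subseteq> {0..1}" using rx(1)[of i] x[of i] by auto
    then show "continuous_on {r * x i..x i} \<phi>'"
      using continuous_deriv continuous_on_subset by blast
    show "\<phi>' (r * x i) \<le> \<phi>' (x i) - t / a i"
      using t_le[OF i] weight_pos[of i] by (simp add: gap_def field_simps)
    show "\<phi>' (x i) - t / a i \<le> \<phi>' (x i)" using t weight_pos[of i] by simp
  qed (rule rx)
  then obtain z where z: "\<And>i. i \<in> S \<Longrightarrow> r * x i \<le> z i \<and> z i \<le> x i \<and> \<phi>' (z i) = \<phi>' (x i) - t / a i"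
    by metis
  define y where "y i = (if i \<in> S then z i else x i)" for i
  have y: "y i \<in> {0..1}" for i
    using z[of i] x[of i] rx(1)[of i] by (auto simp: y_def)
  define \<delta> where "\<delta> i = (if i \<in> S then base x i - base y i else 0)" for i
  have "\<delta> sums sum (\<lambda>i. base x i - base y i) S"
    unfolding \<delta>_def by (rule sums_If_finite_set[OF fin])
  moreover have "base y = (\<lambda>i. base x i - \<delta> i)"
    by (auto simp: \<delta>_def base_def y_def)
  ultimately have sumy: "base y sums (suminf (base x) - sum (\<lambda>i. base x i - base y i) S)"
    using sx by (auto intro: sums_diff summable_sums)
  have drop: "y i * t \<le> base x i - base y i" if i: "i \<in> S" for i
  proof -
    have "y i * t = a i * (y i * (\<phi>' (x i) - \<phi>' (y i)))"
      using z[OF i] weight_pos[of i] i by (simp add: y_def)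
    also have "\<dots> \<le> a i * (\<dd> 0 (x i) - \<dd> 0 (y i))"
      using zero_divergence_diff[OF x y] weight_pos[of i] by (intro mult_left_mono) auto
    finally show ?thesis by (simp add: base_def algebra_simps)
  qed
  have "1 < sum y S"
  proof -
    have "(\<Sum>i\<in>S. r * x i) \<le> sum y S"
      using z by (intro sum_mono) (simp add: y_def)
    then show ?thesis using r1 by simp
  qed
  then have "t < sum y S * t" using t by simp
  also have "\<dots> \<le> sum (\<lambda>i. base x i - base y i) S"
    unfolding sum_distrib_right by (intro sum_mono drop)
  finally have less: "suminf (base y) < suminf (base x) - t"
    using sumy by (simp add: sums_iff)
  have "score y k < score x k" for k
  proof (cases "k \<in> S")
    case True
    then have "a k * (\<phi>' (x k) - \<phi>' (y k)) = t"
      using z[of k] weight_pos[of k] by (simp add: y_def)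
    then show ?thesis using less by (simp add: score_def algebra_simps)
  next
    case False
    then show ?thesis using less t by (simp add: score_def y_def)
  qed
  then show thesis using that y sumy by (auto simp: sums_iff)
qed

end

section \<open>From sequences of credences to dominance on the opinion space\<close>

theorem theorem4p26:
  fixes W :: "'w set" and F :: "'w set set"
    and \<I> :: "('w set \<Rightarrow> real) \<Rightarrow> 'w \<Rightarrow> ennreal"
    and c :: "'w set \<Rightarrow> real"
  assumes "opinion_space W F"
    and "partition_on W F" and "countable F" and "infinite F"
    and "generalized_legitimate_inaccuracy_measure W F \<I>"
    and "credence_function F c"
  shows "(coherent W F c \<longleftrightarrow> \<not> (\<exists>d. credence_function F d \<and> weakly_dominates W \<I> d c)) \<and>
         (coherent W F c \<longleftrightarrow> \<not> (\<exists>d. credence_function F d \<and> strongly_dominates W \<I> d c))"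
proof -
  obtain p a \<dd> where p: "bij_betw p UNIV F"
    and a: "\<forall>i. 0 < a i" "bdd_above (range a)" and \<dd>: "bounded_bregman_divergence \<dd>"
    and \<I>: "\<And>d w. credence_function F d \<Longrightarrow> w \<in> W \<Longrightarrow>
      \<I> d w = (\<Sum>i. ennreal (a i * \<dd> (indicator (p i) w) (d (p i))))"
    using assms(5) unfolding generalized_legitimate_inaccuracy_measure_def by blast
  obtain \<phi> \<phi>' where "bregman \<dd> \<phi> \<phi>'" using \<dd> by (rule bounded_bregman_divergenceE)
  then interpret weighted_bregman \<dd> \<phi> \<phi>' a
    using a by (auto simp: weighted_bregman_def weighted_bregman_axioms_def)
  have F: "F = range p" and "inj p" using p by (auto simp: bij_betw_def)
  have pne: "p i \<noteq> {}" for i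
    using assms(2) F by (metis partition_onD3 rangeI)
  have disj: "disjoint_family p"
    unfolding disjoint_family_on_def
    using partition_onD2[OF assms(2)] \<open>inj p\<close> F by (metis disjointD injD rangeI)
  have cover: "(\<Union>i. p i) = W" using partition_onD1[OF assms(2)] F by simp
  have cred: "d (p i) \<in> {0..1}" if "credence_function F d" for d i
    using that F unfolding credence_function_def by blast
  have fin: "\<I> d w = ennreal (score (\<lambda>i. d (p i)) k)" "0 \<le> score (\<lambda>i. d (p i)) k"
    if "credence_function F d" "w \<in> p k" "summable (base (\<lambda>i. d (p i)))" for d w k
    using suminf_inaccuracy(1)[of "\<lambda>i. d (p i)" p w k] that(2,3) cred[OF that(1)] disj \<I>[OF that(1), of w] cover by auto
  have inf: "\<I> d w = top"
    if "credence_function F d" "w \<in> p k" "\<not> summable (base (\<lambda>i. d (p i)))" for d w k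
    using suminf_inaccuracy(2)[of "\<lambda>i. d (p i)" p w k] that(2,3) cred[OF that(1)] disj \<I>[OF that(1), of w] cover by auto
  define x where "x = (\<lambda>i. c (p i))"
  have x: "x i \<in> {0..1}" for i using cred assms(6) by (simp add: x_def)

  have undominated: "\<not> weakly_dominates W \<I> d c" if coh: "coherent W F c" and d: "credence_function F d" for d
  proof
    assume dom: "weakly_dominates W \<I> d c"
    define y where "y = (\<lambda>i. d (p i))"
    have y: "y i \<in> {0..1}" for i using cred d by (simp add: y_def)
    have le1: "sum x {..<n} \<le> 1" for n
      unfolding x_def using coh disj
      by (intro coherent_sum_le_1) (auto simp: F disjoint_family_on_def)
    have sx: "summable x"
      using x le1 by (intro summableI_nonneg_bounded[where x=1]) auto
    then have x1: "suminf x \<le> 1"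
      using le1 by (intro suminf_le_const) auto
    have bx: "summable (base x)" using x sx by (rule summable_base)
    have le: "\<I> d w \<le> \<I> c w" if "w \<in> W" for w
      using dom that unfolding weakly_dominates_def by blast
    \<comment> \<open>Otherwise \<open>d\<close> would be infinitely inaccurate at a world where
      \<open>c\<close> has finite inaccuracy.\<close>
    have sy: "summable (base y)"
    proof (rule ccontr)
      assume ns: "\<not> summable (base y)"
      obtain w where w: "w \<in> p 0" using pne by blast
      have "\<I> d w = top" using inf[OF d w] ns by (simp add: y_def)
      moreover have "\<I> c w \<noteq> top" using fin[OF assms(6) w] bx by (simp add: x_def)
      ultimately show False using le[of w] w cover by (auto simp: top_unique)
    qed
    have "score y k \<le> score x k" for k
    proof -
      obtain w where w: "w \<in> p k" using pne by blast
      have "ennreal (score y k) \<le> ennreal (score x k)"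
        using le[of w] w cover fin[OF d w] fin[OF assms(6) w] bx sy by (auto simp: x_def y_def)
      then show ?thesis using fin(2)[OF assms(6) w] bx by (simp add: x_def)
    qed
    then have "y i = x i" for i by (rule eq_if_score_le[OF x y sx x1 sy])
    then have "\<I> d w = \<I> c w" if "w \<in> W" for w
      using \<I>[OF d that] \<I>[OF assms(6) that] by (simp add: x_def y_def)
    then show False using dom unfolding weakly_dominates_def by auto
  qed

  have dominated: "\<exists>d. credence_function F d \<and> strongly_dominates W \<I> d c" if inc: "\<not> coherent W F c"
  proof -
    obtain n where n: "1 < sum x {..<n}"
      using coherentI_finite_sums[OF cover disj pne, of c] inc x
      unfolding F x_def by (metis atLeastAtMost_iff not_le)
    \<comment> \<open>If \<open>base x\<close> diverges, \<open>c\<close> is infinitely inaccurate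
      everywhere, so any \<open>y\<close> with summable \<open>base y\<close> will do; zero is the
      simplest.\<close>
    have "\<exists>y. (\<forall>i. y i \<in> {0..1}) \<and> summable (base y) \<and> (summable (base x) \<longrightarrow> (\<forall>k. score y k < score x k))"
    proof (cases "summable (base x)")
      case True
      then show ?thesis using ex_score_less[of x n] x n by metis
    next
      case False
      have "base (\<lambda>_. 0) = (\<lambda>_. 0)" by (simp add: base_def fun_eq_iff)
      then show ?thesis using False by (intro exI[of _ "\<lambda>_. 0"]) auto
    qed
    then obtain y where y: "\<And>i. y i \<in> {0..1}" "summable (base y)"
      and less: "summable (base x) \<Longrightarrow> score y k < score x k" for k by blast
    define d where "d q = y (inv p q)" for q
    have dp: "d (p i) = y i" for i using \<open>inj p\<close> by (simp add: d_def)
    have d: "credence_function F d"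
      using y dp by (auto simp: credence_function_def F)
    have "\<I> d w < \<I> c w" if w: "w \<in> W" for w
    proof -
      obtain k where k: "w \<in> p k" using w cover by blast
      have dw: "\<I> d w = ennreal (score y k)" "0 \<le> score y k"
        using fin[OF d k] y by (simp_all add: dp)
      show ?thesis
      proof (cases "summable (base x)")
        case True
        then have "\<I> c w = ennreal (score x k)" using fin[OF assms(6) k] by (simp add: x_def)
        then show ?thesis using dw less[OF True] by (simp add: ennreal_less_iff)
      next
        case False
        then have "\<I> c w = top" using inf[OF assms(6) k] by (simp add: x_def)
        then show ?thesis using dw by simp
      qed
    qed
    then show ?thesis using d unfolding strongly_dominates_def by blast
  qed
  \<comment> \<open>Nonemptiness of \<open>W\<close> supplies a world of strict inequality. This
    closes the cycle: coherent, not weakly dominated, not strongly dominated, coherent.\<close>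
  have "weakly_dominates W \<I> d c" if "strongly_dominates W \<I> d c" for d
    using that assms(1) unfolding weakly_dominates_def strongly_dominates_def opinion_space_def
    by (auto intro: less_imp_le)
  then show ?thesis using undominated dominated by blast
qed

end
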